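(* If $s\geq 1$ is an integer, then there is an integer $n>s$ such that for every integer $t\geq 1$ there is a graph $G$ of order $snt$ with $$\lambda_{s^{2}+1}^{\ast}(G)=\frac{nt}{2}.$$
   Context: Graphs are finite, simple and undirected; the order of a graph is its number of vertices. For a graph $G$, $\lambda_i^{\ast}(G)$ denotes the $i$'th largest singular value of its adjacency matrix, i.e. the $i$'th largest of the absolute values of its adjacency eigenvalues (with multiplicity). *)

theory Defs
  imports
    "Jordan_Normal_Form.Char_Poly"
    "Graph_Theory.Pair_Digraph"
    "HOL-Computational_Algebra.Polynomial"
begin

text \<open>
  Finite simple undirected graphs are the symmetric loop-free digraphs of the locale
  \<^locale>\<open>pair_graph\<close>: an edge \<open>{u, v}\<close> is represented by the two arcs \<open>(u, v)\<close> and \<open>(v, u)\<close>.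
  Rows and columns of the adjacency matrix follow the increasing order of the vertices; another
  order conjugates the matrix by a permutation matrix and leaves the singular values unchanged.
\<close>

definition adjacency_matrix :: "'a::linorder pair_pre_digraph \<Rightarrow> real mat" where
  "adjacency_matrix G =
     (let vs = sorted_list_of_set (pverts G); n = card (pverts G)
      in mat n n (\<lambda>(i, j). of_bool ((vs ! i, vs ! j) \<in> parcs G)))"

text \<open>
  The singular values of a matrix \<open>A\<close> are the square roots of the eigenvalues of the positive
  semidefinite matrix \<open>A\<^sup>T A\<close>. All complex roots of its characteristic polynomial are real and
  nonnegative, so the multiset of real roots has as many elements as \<open>A\<close> has columns. When \<open>A\<close>
  is symmetric, these are the absolute values of the eigenvalues of \<open>A\<close>, with multiplicity.
\<close>

definition singular_values :: "real mat \<Rightarrow> real multiset" where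
  "singular_values A = image_mset sqrt (proots (char_poly (transpose_mat A * A)))"

text \<open>The index \<open>i\<close> counts from 1 and is meaningful for \<open>1 \<le> i \<le> card (pverts G)\<close>.\<close>

definition graph_singular_value :: "nat \<Rightarrow> 'a::linorder pair_pre_digraph \<Rightarrow> real" where
  "graph_singular_value i G =
     rev (sorted_list_of_multiset (singular_values (adjacency_matrix G))) ! (i - 1)"

end

theory Submission
  imports Defs
begin

text \<open>
  Take \<open>n = 2 ^ s\<close> and \<open>m = n * t\<close>. Repeating \<open>s\<close> of the non-constant rows of Sylvester's Hadamard matrix
  \<open>t\<close> times gives \<open>s\<close> pairwise orthogonal vectors \<open>h\<^sub>1, \<dots>, h\<^sub>s \<in> {1, -1}\<^sup>m\<close>, each with entry
  sum \<open>0\<close>; the condition \<open>n > s\<close> is exactly what leaves room for \<open>s\<close> of them.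
  On the vertices \<open>(i, a)\<close> with \<open>i\<close> among \<open>s\<close> block indices and \<open>a < m\<close>, join \<open>(i, a)\<close> to
  \<open>(j, b)\<close> when \<open>h\<^sub>j(a) h\<^sub>i(b) = -1\<close>. This relation is symmetric, and it has no loops because
  \<open>h\<^sub>i(a)\<^sup>2 = 1\<close>. The adjacency matrix is \<open>A = (J - B) / 2\<close>, where \<open>J\<close> is the all-ones matrix and
  the \<open>(i, j)\<close> block of \<open>B\<close> is the rank-one matrix \<open>h\<^sub>j h\<^sub>i\<^sup>T\<close>.

  The matrix \<open>B\<close> annihilates the all-ones vector, maps \<open>e\<^sub>j \<otimes> h\<^sub>i\<close> to \<open>m\<close> times
  \<open>e\<^sub>i \<otimes> h\<^sub>j\<close>, and vanishes on the orthogonal complement of these \<open>s\<^sup>2\<close> vectors. So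
  the singular values of \<open>A\<close>, in decreasing order, are \<open>s * m / 2\<close>, then \<open>s\<^sup>2\<close> copies of
  \<open>m / 2\<close>, then zeros, and the one with index \<open>s\<^sup>2 + 1\<close> is \<open>m / 2 = n * t / 2\<close>.

  To read the multiplicities off a characteristic polynomial, write \<open>A\<^sup>T A = W W\<^sup>T\<close> with
  the all-ones vector and the vectors \<open>e\<^sub>i \<otimes> h\<^sub>k\<close>, suitably scaled, as columns of \<open>W\<close>. These
  columns are orthogonal, so \<open>W\<^sup>T W\<close> is diagonal, and \<open>W W\<^sup>T\<close> and \<open>W\<^sup>T W\<close> have the same
  characteristic polynomial up to a power of the indeterminate (\<open>char_poly_mult_swap\<close>). This
  is \<open>singular_values_via_orthogonal_columns\<close>; the two Gram computations are
  \<open>sum_adjacency_columns\<close> with \<open>sum_factor_rows\<close>, and \<open>sum_factor_columns\<close>.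
\<close>

section \<open>The nonzero spectrum of a product\<close>

lemma char_poly_four_block_mat_lower_left:
  fixes A :: "'a :: idom mat"
  assumes A: "A \<in> carrier_mat n n" and C: "C \<in> carrier_mat r n" and D: "D \<in> carrier_mat r r"
  shows "char_poly (four_block_mat A (0\<^sub>m n r) C D) = char_poly A * char_poly D"
proof -
  let ?P = "char_poly_matrix :: 'a mat \<Rightarrow> 'a poly mat"
  have "?P (four_block_mat A (0\<^sub>m n r) C D) =
    four_block_mat (?P A) (0\<^sub>m n r) (map_mat (\<lambda>a. [:- a:]) C) (?P D)"
    unfolding char_poly_matrix_def using A C D by (intro eq_matI) (auto simp: one_poly_def)
  then show ?thesis
    unfolding char_poly_def
    using A C D by (simp add: det_four_block_mat_upper_right_zero[where n = n and m = r])
qed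

lemma char_poly_zero_mat: "char_poly (0\<^sub>m n n :: 'a :: idom mat) = [:0, 1:] ^ n"
proof -
  have "char_poly_matrix (0\<^sub>m n n :: 'a mat) = [:0, 1:] \<cdot>\<^sub>m 1\<^sub>m n"
    unfolding char_poly_matrix_def by (intro eq_matI) auto
  then show ?thesis unfolding char_poly_def by simp
qed

text \<open>
  Conjugation by the block matrix with rows \<open>(1, X)\<close> and \<open>(0, 1)\<close> turns the block matrix with
  rows \<open>(0, 0)\<close> and \<open>(Y, Y X)\<close> into the one with rows \<open>(X Y, 0)\<close> and \<open>(Y, 0)\<close>. Both are
  block triangular, so comparing characteristic polynomials gives the identity over any integral
  domain and for rectangular \<open>X\<close> and \<open>Y\<close>.
\<close>

lemma char_poly_mult_swap:
  fixes X :: "'a :: idom mat"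
  assumes X: "X \<in> carrier_mat n r" and Y: "Y \<in> carrier_mat r n"
  shows "char_poly (X * Y) * [:0, 1:] ^ r = [:0, 1:] ^ n * char_poly (Y * X)"
proof -
  let ?L = "four_block_mat (X * Y) (0\<^sub>m n r) Y (0\<^sub>m r r)"
  let ?R = "four_block_mat (0\<^sub>m n n) (0\<^sub>m n r) Y (Y * X)"
  let ?P = "four_block_mat (1\<^sub>m n) X (0\<^sub>m r n) (1\<^sub>m r)"
  let ?Q = "four_block_mat (1\<^sub>m n) (- X) (0\<^sub>m r n) (1\<^sub>m r)"
  have one: "four_block_mat (1\<^sub>m n) (0\<^sub>m n r) (0\<^sub>m r n) (1\<^sub>m r) = (1\<^sub>m (n + r) :: 'a mat)"
    by (intro eq_matI) auto
  have zero: "- 0\<^sub>m r r = (0\<^sub>m r r :: 'a mat)" by (intro eq_matI) auto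
  have XY: "X * Y \<in> carrier_mat n n" and YX: "Y * X \<in> carrier_mat r r" using X Y by auto
  have XYX: "X * (Y * X) \<in> carrier_mat n r" using X Y by auto
  note block = mult_four_block_mat[where ?nr1.0 = n and ?n1.0 = n and ?n2.0 = r and ?nr2.0 = r
      and ?nc1.0 = n and ?nc2.0 = r]
  have "similar_mat ?L ?R"
  proof (rule similar_matI)
    show "{?L, ?R, ?P, ?Q} \<subseteq> carrier_mat (n + r) (n + r)" using X Y by auto
    have "?P * ?Q = four_block_mat (1\<^sub>m n) (- X + X) (0\<^sub>m r n) (1\<^sub>m r)"
      using X by (subst block) (auto simp: zero)
    then show "?P * ?Q = 1\<^sub>m (n + r)" using X by (simp add: one)
    have "?Q * ?P = four_block_mat (1\<^sub>m n) (X + - X) (0\<^sub>m r n) (1\<^sub>m r)"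
      using X by (subst block) auto
    moreover have "X + - X = 0\<^sub>m n r" using X by (intro eq_matI) auto
    ultimately show "?Q * ?P = 1\<^sub>m (n + r)" by (simp add: one)
    have "?P * ?R = four_block_mat (X * Y) (X * (Y * X)) Y (Y * X)"
      using X Y XY YX XYX by (subst block) auto
    then have "?P * ?R * ?Q = four_block_mat (X * Y) (X * (Y * X)) Y (Y * X) * ?Q" by simp
    also have "\<dots> =
      four_block_mat (X * Y) (X * Y * - X + X * (Y * X)) Y (Y * - X + Y * X)"
      using X Y XY YX XYX by (subst block) auto
    also have "X * Y * - X + X * (Y * X) = 0\<^sub>m n r"
      using X Y XYX by (simp add: assoc_mult_mat[OF X Y X])
    also have "Y * - X + Y * X = 0\<^sub>m r r"
      using X Y YX by simp
    finally show "?L = ?P * ?R * ?Q" by simp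
  qed
  from char_poly_similar[OF this] show ?thesis
    using char_poly_four_block_mat_lower_left[OF XY Y zero_carrier_mat]
      char_poly_four_block_mat_lower_left[OF zero_carrier_mat Y YX]
    by (simp add: char_poly_zero_mat)
qed

lemma proots_power_X: "proots ([:0, 1:] ^ n :: 'a :: idom poly) = replicate_mset n 0"
  by (simp add: proots_power proots_linear_factor[of 0, simplified])

lemma proots_prod_list_linear:
  "proots (\<Prod>a\<leftarrow>as. [:- a, 1 :: 'a :: idom:]) = mset as"
proof (induction as)
  case (Cons a as)
  have "(\<Prod>a\<leftarrow>as. [:- a, 1 :: 'a:]) \<noteq> 0" by (auto simp: prod_list_zero_iff)
  with Cons show ?case by (simp add: proots_mult del: mult_pCons_left)
qed simp

lemma proots_char_poly_diagonal:
  fixes ds :: "'a :: idom list"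
  shows "proots (char_poly (mat (length ds) (length ds) (\<lambda>(i, j). if i = j then ds ! i else 0))) =
    mset ds" (is "proots (char_poly ?D) = _")
proof -
  have "diag_mat ?D = ds" by (intro nth_equalityI) (auto simp: diag_mat_def)
  moreover have "char_poly ?D = (\<Prod>a\<leftarrow>diag_mat ?D. [:- a, 1:])"
    by (rule char_poly_upper_triangular) auto
  ultimately show ?thesis by (simp add: proots_prod_list_linear)
qed

text \<open>
  Orthogonal columns of \<open>W\<close> make the smaller Gram matrix diagonal with the squared column norms
  on the diagonal. Swapping the factors transfers these roots to \<open>A\<^sup>T A\<close> and adds only zeros.
\<close>

lemma singular_values_via_orthogonal_columns:
  assumes A: "A \<in> carrier_mat n n" and W: "W \<in> carrier_mat n (length ds)" and le: "length ds \<le> n"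
    and gram: "transpose_mat A * A = W * transpose_mat W"
    and orth: "transpose_mat W * W =
      mat (length ds) (length ds) (\<lambda>(i, j). if i = j then ds ! i else 0)"
  shows "singular_values A = mset (map sqrt ds @ replicate (n - length ds) 0)"
proof -
  let ?r = "length ds"
  let ?p = "char_poly (transpose_mat A * A)" and ?q = "char_poly (transpose_mat W * W)"
  have "?p * [:0, 1:] ^ ?r = [:0, 1:] ^ n * ?q"
    unfolding gram using char_poly_mult_swap[OF W transpose_carrier_mat[THEN iffD2, OF W]] .
  moreover have "?p \<noteq> 0" "?q \<noteq> 0"
    using degree_monic_char_poly[of "transpose_mat A * A" n] A
      degree_monic_char_poly[of "transpose_mat W * W" ?r] W by auto
  ultimately have "proots ?p + replicate_mset ?r 0 = replicate_mset n 0 + proots ?q"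
    by (metis proots_mult proots_power_X pCons_eq_0_iff one_neq_zero power_not_zero)
  moreover have "proots ?q = mset ds" unfolding orth by (rule proots_char_poly_diagonal)
  moreover have "replicate_mset n (0 :: real) = replicate_mset (n - ?r) 0 + replicate_mset ?r 0"
    using le by (intro multiset_eqI) auto
  ultimately have "proots ?p + replicate_mset ?r 0 =
      (mset ds + replicate_mset (n - ?r) 0) + replicate_mset ?r 0"
    by (simp only: ac_simps)
  then have "proots ?p = mset ds + replicate_mset (n - ?r) 0"
    by (rule add_right_imp_eq)
  then show ?thesis unfolding singular_values_def by simp
qed

section \<open>Sign vectors\<close>

text \<open>
  The number \<open>q = i * b + k\<close> encodes the pair \<open>(i, k)\<close>. All double indices below, for
  vertices, for columns and for positions in repeated vectors, use this encoding, and double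
  sums over them are evaluated by this lemma.
\<close>

lemma sum_div_mod:
  fixes f :: "nat \<Rightarrow> nat \<Rightarrow> 'a :: comm_monoid_add"
  shows "(\<Sum>q<a * b. f (q div b) (q mod b)) = (\<Sum>i<a. \<Sum>k<b. f i k)"
proof -
  have "(\<Sum>q = i * b..<i * b + b. f (q div b) (q mod b)) = (\<Sum>k<b. f i k)" for i
    using sum.shift_bounds_nat_ivl[of "\<lambda>q. f (q div b) (q mod b)" 0 "i * b" b]
    by (simp add: add.commute atLeast0LessThan)
  then show ?thesis by (simp flip: sum.nat_group)
qed

text \<open>
  The \<open>d\<close>-fold Kronecker power of the \<open>2 \<times> 2\<close> Hadamard matrix, that is
  \<open>(-1)\<^sup>c\<close> for the number \<open>c\<close> of common binary digits \<open>1\<close> of \<open>j\<close> and \<open>a\<close> among the lowest \<open>d\<close>.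
\<close>

fun sylvester :: "nat \<Rightarrow> nat \<Rightarrow> nat \<Rightarrow> real" where
  "sylvester 0 j a = 1"
| "sylvester (Suc d) j a =
     sylvester d (j div 2) (a div 2) * (if odd j \<and> odd a then - 1 else 1)"

lemma sylvester_sign: "sylvester d j a = 1 \<or> sylvester d j a = - 1"
  by (induction d arbitrary: j a) auto

lemma sylvester_0 [simp]: "sylvester d 0 a = 1"
  by (induction d arbitrary: a) auto

text \<open>
  Splitting off the last binary digit of \<open>a\<close> factors the sum into the one for \<open>d\<close> and the inner
  product of two rows of the \<open>2 \<times> 2\<close> matrix, which vanishes when \<open>j\<close> and \<open>k\<close> differ
  in their last digit.
\<close>

lemma sylvester_orthogonal:
  assumes "j < 2 ^ d" "k < 2 ^ d"
  shows "(\<Sum>a<2 ^ d. sylvester d j a * sylvester d k a) = (if j = k then 2 ^ d else 0)"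
  using assms
proof (induction d arbitrary: j k)
  case (Suc d)
  let ?S = "\<lambda>j k a. sylvester d (j div 2) a * sylvester d (k div 2) a"
  let ?e = "\<lambda>j b. if odd j \<and> odd (b :: nat) then - 1 else 1 :: real"
  have "(\<Sum>a<2 ^ Suc d. sylvester (Suc d) j a * sylvester (Suc d) k a) =
    (\<Sum>a<2 ^ d * 2. ?S j k (a div 2) * (?e j (a mod 2) * ?e k (a mod 2)))"
    by (rule sum.cong) (auto simp: odd_iff_mod_2_eq_one mult.commute)
  also have "\<dots> = (\<Sum>a<2 ^ d. \<Sum>b<2. ?S j k a * (?e j b * ?e k b))"
    by (rule sum_div_mod)
  also have "\<dots> = (\<Sum>a<2 ^ d. ?S j k a) * (1 + ?e j 1 * ?e k 1)"
    unfolding sum_distrib_right by (rule sum.cong) (auto simp: numeral_2_eq_2)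
  also have "(\<Sum>a<2 ^ d. ?S j k a) = (if j div 2 = k div 2 then 2 ^ d else 0)"
    using Suc.prems by (intro Suc.IH) auto
  also have "(if j div 2 = k div 2 then 2 ^ d else 0) * (1 + ?e j 1 * ?e k 1) =
    (if j = k then 2 ^ Suc d else 0)"
  proof -
    have "j = k \<longleftrightarrow> j div 2 = k div 2 \<and> (odd j \<longleftrightarrow> odd k)" by presburger
    then show ?thesis by auto
  qed
  finally show ?case .
qed simp

section \<open>The graph of a system of balanced sign vectors\<close>

text \<open>
  The spectrum of the graph depends only on these relations between the vectors. In particular the
  vectors may be repetitions of shorter ones, which is how \<open>t\<close> enters.
\<close>

locale balanced_signs =
  fixes s m :: nat and h :: "nat \<Rightarrow> nat \<Rightarrow> real"
  assumes s_pos: "1 \<le> s" and s_less: "s < m"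
    and sign: "h k a = 1 \<or> h k a = - 1"
    and balanced: "k < s \<Longrightarrow> (\<Sum>a<m. h k a) = 0"
    and orthogonal: "\<lbrakk>j < s; k < s\<rbrakk> \<Longrightarrow>
      (\<Sum>a<m. h j a * h k a) = (if j = k then real m else 0)"
begin

definition sign_graph :: "nat pair_pre_digraph" where
  "sign_graph = \<lparr>pverts = {..<s * m},
     parcs = {(p, q). p < s * m \<and> q < s * m \<and>
       h (q div m) (p mod m) * h (p div m) (q mod m) = - 1}\<rparr>"

lemma pair_graph_sign_graph: "pair_graph sign_graph"
proof -
  have "finite (parcs sign_graph)"
    by (rule finite_subset[of _ "{..<s * m} \<times> {..<s * m}"]) (auto simp: sign_graph_def)
  moreover have "h k a * h k a \<noteq> - 1" for k a using sign[of k a] by auto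
  ultimately show ?thesis
    by unfold_locales
      (auto simp: sign_graph_def symmetric_def arcs_ends_def arc_to_ends_def sym_def mult.commute)
qed

definition adjacency :: "nat \<Rightarrow> nat \<Rightarrow> real" where
  "adjacency p q = (1 - h (q div m) (p mod m) * h (p div m) (q mod m)) / 2"

text \<open>
  For signs, \<open>(1 - x y) / 2\<close> is the indicator of \<open>x y = -1\<close>.
\<close>

lemma adjacency_matrix_sign_graph:
  "adjacency_matrix sign_graph = mat (s * m) (s * m) (\<lambda>(p, q). adjacency p q)"
proof -
  have *: "of_bool (x * y = - 1) = (1 - x * y) / 2"
    if "x = 1 \<or> x = - 1" "y = 1 \<or> y = - 1" for x y :: real
    using that by auto
  have "sorted_list_of_set {..<s * m} = [0..<s * m]"
    using sorted_list_of_set_range[of 0 "s * m"] by (simp add: atLeast0LessThan)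
  then show ?thesis
    unfolding adjacency_matrix_def adjacency_def
    by (intro eq_matI) (auto simp: sign_graph_def Let_def *[OF sign sign])
qed

text \<open>
  Column \<open>0\<close> is constant; column \<open>i * s + k + 1\<close> is a multiple of \<open>e\<^sub>i \<otimes> h\<^sub>k\<close>. The scalars
  make the sum of \<open>w w\<^sup>T\<close> over the columns \<open>w\<close> equal to the square of the adjacency matrix.
\<close>

definition factor :: "nat \<Rightarrow> nat \<Rightarrow> real" where
  "factor p c = (case c of 0 \<Rightarrow> sqrt (s * m) / 2
     | Suc q \<Rightarrow> of_bool (p div m = q div s) * (sqrt m / 2 * h (q mod s) (p mod m)))"

text \<open>
  On expanding the product, the terms linear in \<open>h\<close> vanish by balance. The term \<open>1\<close>
  gives the multiple of \<open>J\<close>, and orthogonality confines the term of degree four to the diagonal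
  blocks.
\<close>

lemma sum_adjacency_columns:
  assumes "p < s * m" "q < s * m"
  shows "(\<Sum>r<s * m. adjacency r p * adjacency r q) =
    m / 4 * (s + of_bool (p div m = q div m) * (\<Sum>k<s. h k (p mod m) * h k (q mod m)))"
proof -
  let ?i = "p div m" and ?a = "p mod m" and ?j = "q div m" and ?b = "q mod m"
  have ij: "?i < s" "?j < s" using assms by (auto simp: less_mult_imp_div_less)
  have "(\<Sum>r<s * m. adjacency r p * adjacency r q) =
    (\<Sum>k<s. \<Sum>c<m. (1 - h ?i c * h k ?a) / 2 * ((1 - h ?j c * h k ?b) / 2))"
    unfolding adjacency_def by (rule sum_div_mod)
  also have "\<dots> = (\<Sum>k<s. 1 / 4 * (m - h k ?a * (\<Sum>c<m. h ?i c) - h k ?b * (\<Sum>c<m. h ?j c)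
      + h k ?a * h k ?b * (\<Sum>c<m. h ?i c * h ?j c)))"
    by (intro sum.cong refl)
      (simp add: sum_distrib_left sum.distrib sum_subtractf algebra_simps sum_divide_distrib[symmetric]
        add_divide_distrib diff_divide_distrib)
  also have "\<dots> = (\<Sum>k<s. m / 4 * (1 + of_bool (?i = ?j) * (h k ?a * h k ?b)))"
    using ij by (intro sum.cong refl) (simp add: balanced orthogonal algebra_simps)
  also have "\<dots> = m / 4 * (s + of_bool (?i = ?j) * (\<Sum>k<s. h k ?a * h k ?b))"
    by (simp only: sum_distrib_left[symmetric] sum.distrib) simp
  finally show ?thesis .
qed

lemma sum_factor_rows:
  assumes "p < s * m" "q < s * m"
  shows "(\<Sum>c<Suc (s * s). factor p c * factor q c) =
    m / 4 * (s + of_bool (p div m = q div m) * (\<Sum>k<s. h k (p mod m) * h k (q mod m)))"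
proof -
  let ?i = "p div m" and ?a = "p mod m" and ?j = "q div m" and ?b = "q mod m"
  have ij: "?i < s" using assms by (auto simp: less_mult_imp_div_less)
  have "(\<Sum>c<Suc (s * s). factor p c * factor q c) = factor p 0 * factor q 0 + (\<Sum>c<s * s. factor p (Suc c) * factor q (Suc c))"
    by (rule sum.lessThan_Suc_shift)
  also have "factor p 0 * factor q 0 = m / 4 * s" by (simp add: factor_def)
  also have "(\<Sum>c<s * s. factor p (Suc c) * factor q (Suc c)) =
     (\<Sum>l<s. \<Sum>k<s. of_bool (?i = l) * (sqrt m / 2 * h k ?a) *
       (of_bool (?j = l) * (sqrt m / 2 * h k ?b)))"
    unfolding factor_def nat.case by (rule sum_div_mod)
  also have "\<dots> = (\<Sum>l<s. if ?i = l then
      m / 4 * (of_bool (?i = ?j) * (\<Sum>k<s. h k ?a * h k ?b)) else 0)"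
    by (intro sum.cong refl) (auto simp: sum_distrib_left mult_ac intro!: sum.cong)
  also have "\<dots> = m / 4 * (of_bool (?i = ?j) * (\<Sum>k<s. h k ?a * h k ?b))"
    using ij by simp
  finally show ?thesis by (simp add: algebra_simps)
qed

lemma sum_factor_columns:
  assumes "c < Suc (s * s)" "d < Suc (s * s)"
  shows "(\<Sum>p<s * m. factor p c * factor p d) =
    (if c = d then (if c = 0 then (s * m / 2)\<^sup>2 else (m / 2)\<^sup>2) else 0)"
proof -
  have zero: "factor p 0 = sqrt (s * m) / 2" for p by (simp add: factor_def)
  have mixed: "(\<Sum>p<s * m. factor p (Suc x)) = 0" for x
  proof -
    have "(\<Sum>p<s * m. factor p (Suc x)) =
      (\<Sum>i<s. \<Sum>a<m. of_bool (i = x div s) * (sqrt m / 2 * h (x mod s) a))"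
      unfolding factor_def nat.case by (rule sum_div_mod)
    also have "\<dots> = 0"
      using s_pos by (simp only: sum_distrib_left[symmetric]) (simp add: balanced)
    finally show ?thesis .
  qed
  have inner: "(\<Sum>p<s * m. factor p (Suc x) * factor p (Suc y)) = (if x = y then (m / 2)\<^sup>2 else 0)"
    if "x < s * s" "y < s * s" for x y
  proof -
    have xy: "x mod s < s" "y mod s < s" "x div s < s"
      using that s_pos by (auto simp: less_mult_imp_div_less)
    have "(\<Sum>p<s * m. factor p (Suc x) * factor p (Suc y)) =
      (\<Sum>i<s. \<Sum>a<m. of_bool (i = x div s) * (sqrt m / 2 * h (x mod s) a) *
        (of_bool (i = y div s) * (sqrt m / 2 * h (y mod s) a)))"
      unfolding factor_def nat.case by (rule sum_div_mod)
    also have "\<dots> = (\<Sum>i<s. if i = x div s then of_bool (x div s = y div s) *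
        (m / 4 * (\<Sum>a<m. h (x mod s) a * h (y mod s) a)) else 0)"
      by (intro sum.cong refl) (auto simp: sum_distrib_left mult_ac intro!: sum.cong)
    also have "\<dots> = of_bool (x div s = y div s) *
        (m / 4 * (if x mod s = y mod s then real m else 0))"
      using xy by (simp add: orthogonal)
    also have "\<dots> = (if x = y then (m / 2)\<^sup>2 else 0)"
      by (auto simp: power2_eq_square) (metis div_mult_mod_eq)
    finally show ?thesis .
  qed
  show ?thesis
  proof (cases c)
    case 0
    show ?thesis
    proof (cases d)
      case 0
      with \<open>c = 0\<close> show ?thesis by (simp add: zero power2_eq_square)
    next
      case (Suc y)
      with \<open>c = 0\<close> show ?thesis by (simp only: zero sum_distrib_left[symmetric] mixed) simp
    qed
  next
    case (Suc x)
    show ?thesis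
    proof (cases d)
      case 0
      with \<open>c = Suc x\<close> show ?thesis by (simp only: zero sum_distrib_right[symmetric] mixed) simp
    next
      case (Suc y)
      with \<open>c = Suc x\<close> assms show ?thesis by (simp add: inner)
    qed
  qed
qed

lemma singular_values_sign_graph:
  "singular_values (adjacency_matrix sign_graph) =
    mset ((s * m / 2) # replicate (s\<^sup>2) (m / 2) @ replicate (s * m - Suc (s\<^sup>2)) 0)"
proof -
  let ?A = "mat (s * m) (s * m) (\<lambda>(p, q). adjacency p q)"
  let ?W = "mat (s * m) (Suc (s * s)) (\<lambda>(p, c). factor p c)"
  let ?ds = "(s * m / 2)\<^sup>2 # replicate (s * s) ((m / 2)\<^sup>2)"
  \<comment> \<open>The \<open>s\<^sup>2 + 1\<close> columns fit into dimension \<open>s * m\<close> because \<open>m > s\<close>.\<close>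
  have "s * Suc s \<le> s * m" using s_less by (intro mult_le_mono) auto
  then have le: "length ?ds \<le> s * m" using s_pos by simp
  have "transpose_mat ?A * ?A = ?W * transpose_mat ?W"
    by (intro eq_matI)
      (auto simp: scalar_prod_def sum_adjacency_columns sum_factor_rows atLeast0LessThan simp del: sum.lessThan_Suc)
  moreover have "transpose_mat ?W * ?W =
      mat (length ?ds) (length ?ds) (\<lambda>(i, j). if i = j then ?ds ! i else 0)"
    by (intro eq_matI)
      (auto simp: scalar_prod_def sum_factor_columns atLeast0LessThan nth_Cons' simp del: sum.lessThan_Suc)
  ultimately have "singular_values ?A = mset (map sqrt ?ds @ replicate (s * m - length ?ds) 0)"
    using le by (intro singular_values_via_orthogonal_columns) auto
  then show ?thesis
    by (simp add: adjacency_matrix_sign_graph power2_eq_square[of s] real_sqrt_mult)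
qed

text \<open>
  The list of singular values is already decreasing because \<open>s \<ge> 1\<close>. Index \<open>s\<^sup>2\<close>, counted
  from \<open>0\<close>, is the last entry equal to \<open>m / 2\<close>.
\<close>

lemma graph_singular_value_sign_graph: "graph_singular_value (s\<^sup>2 + 1) sign_graph = m / 2"
proof -
  let ?xs = "(s * m / 2) # replicate (s\<^sup>2) (m / 2) @ replicate (s * m - Suc (s\<^sup>2)) (0 :: real)"
  have "real m \<le> real (s * m)" using s_pos by (intro of_nat_mono) simp
  then have "sorted (rev ?xs)"
    by (auto simp: sorted_append)
  then have "sort ?xs = rev ?xs"
    by (intro properties_for_sort) simp_all
  then have "rev (sorted_list_of_multiset (mset ?xs)) = ?xs"
    by (metis rev_rev_ident sorted_list_of_multiset_mset)
  then have "graph_singular_value (s\<^sup>2 + 1) sign_graph = ?xs ! (s\<^sup>2)"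
    by (simp add: graph_singular_value_def singular_values_sign_graph)
  also have "\<dots> = m / 2"
    using s_pos by (simp add: nth_Cons' nth_append)
  finally show ?thesis .
qed

end

text \<open>
  Row \<open>0\<close> of the Hadamard matrix is constant, so orthogonality to it makes the rows
  \<open>1, \<dots>, s\<close> balanced.
\<close>

lemma balanced_signs_sylvester:
  assumes "1 \<le> s" "1 \<le> t"
  shows "balanced_signs s (2 ^ s * t) (\<lambda>k a. sylvester s (Suc k) (a mod 2 ^ s))"
proof
  have periodic: "(\<Sum>a<2 ^ s * t. f (a mod 2 ^ s)) = t * (\<Sum>a<2 ^ s. f a)" for f :: "nat \<Rightarrow> real"
    unfolding mult.commute[of "2 ^ s" t]
    using sum_div_mod[where f = "\<lambda>_. f" and a = t and b = "2 ^ s"] by simp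
  have less: "s < 2 ^ s" by simp
  have idx: "Suc k < 2 ^ s" if "k < s" for k using that less by linarith
  show "1 \<le> s" by fact
  have "2 ^ s * 1 \<le> 2 ^ s * t" using assms by (intro mult_le_mono) auto
  with less show "s < 2 ^ s * t" by linarith
  show "(\<Sum>a<2 ^ s * t. sylvester s (Suc j) (a mod 2 ^ s) * sylvester s (Suc k) (a mod 2 ^ s)) =
    (if j = k then real (2 ^ s * t) else 0)" if "j < s" "k < s" for j k
    using sylvester_orthogonal[of "Suc j" s "Suc k"] that idx by (subst periodic) simp
  show "(\<Sum>a<2 ^ s * t. sylvester s (Suc k) (a mod 2 ^ s)) = 0" if "k < s" for k
    using sylvester_orthogonal[of "Suc k" s 0] that idx by (subst periodic) simp
qed (rule sylvester_sign)

theorem theorem2p26: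
  fixes s :: nat
  assumes "s \<ge> 1"
  shows "\<exists>n::nat. n > s \<and>
    (\<forall>t::nat. t \<ge> 1 \<longrightarrow>
      (\<exists>G :: nat pair_pre_digraph. pair_graph G \<and> card (pverts G) = s * n * t \<and>
         graph_singular_value (s\<^sup>2 + 1) G = real (n * t) / 2))"
proof (intro exI[of _ "2 ^ s"] conjI allI impI)
  show "s < 2 ^ s" by simp
  fix t :: nat
  assume "t \<ge> 1"
  with assms interpret balanced_signs s "2 ^ s * t" "\<lambda>k a. sylvester s (Suc k) (a mod 2 ^ s)"
    by (intro balanced_signs_sylvester)
  have "card (pverts sign_graph) = s * 2 ^ s * t"
    by (simp add: sign_graph_def mult.assoc)
  with pair_graph_sign_graph graph_singular_value_sign_graph
  show "\<exists>G :: nat pair_pre_digraph. pair_graph G \<and> card (pverts G) = s * 2 ^ s * t \<and>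
      graph_singular_value (s\<^sup>2 + 1) G = real (2 ^ s * t) / 2"
    by blast
qed

end
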